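(* Let $n\ge 1$ be an integer. Then there is a bijection between the set $\mathcal{RG}^{(3)}_{n+1}$ of (labelled) oriented Riordan graphs (that is, $3$-Riordan graphs) with $n+1$ vertices and the set $\mathcal{B}_n$ of balanced words of length $2n$ over the alphabet $\{0,1,2\}$, i.e. words of length $2n$ in which each of the letters $0,1,2$ occurs an even number (possibly zero) of times.
   Context: Riordan matrices: for formal power series $g=\sum_{k\ge 0}g_kt^k$ and $f=\sum_{k\ge 1}f_kt^k$ in $\mathbb{Z}[[t]]$ (so $f$ has zero constant term), the Riordan matrix $(g,f)$ is the infinite lower triangular matrix $[\ell_{ij}]_{i,j\ge 0}$ with $\ell_{ij}=[t^i]\,g f^j$, where $[t^k]$ denotes the coefficient of $t^k$. The $m\times m$ leading principal submatrix of $(g,f)$ is denoted $(g,f)_m$. Oriented Riordan graphs ($3$-Riordan graphs): a labelled graph $G$ on the vertex set $\{1,\ldots,m\}$, given by its adjacency matrix $A(G)$ with entries in $\{0,1,2\}$, is a $3$-Riordan graph of order $m$ if there are $g\in\mathbb{Z}[[t]]$ and $f\in t\,\mathbb{Z}[[t]]$ such that $$A(G)\equiv (tg,f)_m+(tg,f)_m^T \pmod 3 .$$ Equivalently, writing $A(G)=(a_{i,j})_{1\le i,j\le m}$, for all $i\ge j$ one has $a_{i,j}=a_{j,i}\equiv [t^{i-2}]\,g f^{j-1}\pmod 3$ (in particular the diagonal is zero). Graphs are labelled: two such graphs are the same if and only if they have the same adjacency matrix. $\mathcal{RG}^{(3)}_m$ denotes the set of all such graphs with $m$ vertices. *)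

theory Defs
  imports
    "HOL-Computational_Algebra.Formal_Power_Series"
    "HOL-Number_Theory.Cong"
    "Jordan_Normal_Form.Matrix"
begin

text \<open>
  Only applied to \<open>f\<close> with zero constant term, in which case the
  matrix is lower triangular. Rows and columns are indexed from 0.
\<close>
definition riordan_matrix :: "int fps \<Rightarrow> int fps \<Rightarrow> nat \<Rightarrow> nat \<Rightarrow> int" where
  "riordan_matrix g f i j = fps_nth (g * f ^ j) i"

definition riordan_submatrix :: "nat \<Rightarrow> int fps \<Rightarrow> int fps \<Rightarrow> int mat" where
  "riordan_submatrix m g f = mat m m (\<lambda>(i, j). riordan_matrix g f i j)"

definition cong_mat :: "int mat \<Rightarrow> int mat \<Rightarrow> int \<Rightarrow> bool" where
  "cong_mat A B k \<longleftrightarrow> dim_row A = dim_row B \<and> dim_col A = dim_col B \<and>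
     (\<forall>i < dim_row A. \<forall>j < dim_col A. [A $$ (i, j) = B $$ (i, j)] (mod k))"

text \<open>
  A labelled graph on the vertices \<open>1, \<dots>, m\<close> is identified with its adjacency
  matrix; vertex \<open>i\<close> corresponds to the row and column of index \<open>i - 1\<close>.
  Symmetry and the zero diagonal are consequences of the congruence.
\<close>
definition oriented_riordan_graphs :: "nat \<Rightarrow> int mat set" where
  "oriented_riordan_graphs m =
     {A \<in> carrier_mat m m. elements_mat A \<subseteq> {0, 1, 2} \<and>
        (\<exists>g f. fps_nth f 0 = 0 \<and>
           cong_mat A
             (riordan_submatrix m (fps_X * g) f + transpose_mat (riordan_submatrix m (fps_X * g) f))
             3)}"

definition balanced_words :: "nat \<Rightarrow> nat list set" where
  "balanced_words n =
     {w. length w = 2 * n \<and> set w \<subseteq> {0, 1, 2} \<and> (\<forall>a \<in> {0, 1, 2}. even (count_list w a))}"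

end

theory Submission
  imports Defs
begin

text \<open>
  Both sets are finite, and their cardinalities satisfy the same recursion: each is \<open>1\<close> for
  \<open>n = 0\<close> and grows by \<open>2 * 9 ^ n\<close> when \<open>n\<close> is replaced by \<open>n + 1\<close>. The bijection is
  obtained from this equality of cardinalities.

  Graphs. Below its diagonal, the adjacency matrix of the graph given by \<open>(g, f)\<close> consists of
  the residues of \<open>[t\<^sup>i] g f\<^sup>j\<close> for \<open>j \<le> i < n\<close>, so graphs on \<open>n + 1\<close> vertices correspond to
  such arrays with \<open>n\<close> rows (\<open>oriented_riordan_graphs_eq_image\<close>, \<open>inj_on_array_graph\<close>). The
  arrays can be counted modulo any prime \<open>p\<close>. Consider one with \<open>n + 1\<close> rows. If \<open>g\<^sub>0\<close> vanishes modulo \<open>p\<close>, then \<open>g = t g'\<close> modulo \<open>p\<close>, and the array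
  is that of \<open>(g', f)\<close> with \<open>n\<close> rows, moved down by one row. If \<open>g\<^sub>0\<close> is a unit, then column \<open>0\<close>
  shows \<open>g\<^sub>0, \<dots>, g\<^sub>n\<close>, and dividing column \<open>1\<close> by \<open>g\<close> recovers \<open>f\<^sub>1, \<dots>, f\<^sub>n\<close>, all modulo \<open>p\<close>;
  the array in turn depends only on these residues, so there are \<open>(p - 1) * p ^ (2 * n)\<close> arrays of this kind. For
  \<open>p = 3\<close> this is \<open>2 * 9 ^ n\<close> (\<open>card_truncated_arrays_Suc\<close>).

  Words. Consider all \<open>9 ^ n\<close> words \<open>w\<close> of length \<open>2 n\<close>. Since the length is even, either no letter
  or exactly two letters occur an odd number of times. In the first case \<open>w\<close> is balanced, and
  the pairs of letters that keep it balanced are the three pairs of equal letters; in the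
  second case the two odd letters have to be prepended, in one of two orders. Hence each
  \<open>w\<close> gives two balanced words of length \<open>2 n + 2\<close>, and each balanced \<open>w\<close> gives one more
  (\<open>card_balanced_words_Suc\<close>).
\<close>

section \<open>Congruence of power series up to a given order\<close>

definition fps_cong :: "int \<Rightarrow> nat \<Rightarrow> int fps \<Rightarrow> int fps \<Rightarrow> bool" where
  "fps_cong m n a b \<longleftrightarrow> (\<forall>i<n. [fps_nth a i = fps_nth b i] (mod m))"

lemma fps_cong_refl: "fps_cong m n a a"
  by (simp add: fps_cong_def)

lemma fps_cong_mult:
  assumes "fps_cong m n a b" and "fps_cong m n c d"
  shows "fps_cong m n (a * c) (b * d)"
  unfolding fps_cong_def fps_mult_nth
proof (intro allI impI cong_sum)
  fix i j assume "i < n" "j \<in> {0..i}"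
  then show "[fps_nth a j * fps_nth c (i - j) = fps_nth b j * fps_nth d (i - j)] (mod m)"
    using assms by (intro cong_mult) (auto simp: fps_cong_def)
qed

lemma fps_cong_power: "fps_cong m n a b \<Longrightarrow> fps_cong m n (a ^ k) (b ^ k)"
  by (induction k) (auto intro: fps_cong_mult fps_cong_refl)

text \<open>
  Strong induction on the coefficient: in \<open>[t\<^sup>i] g f\<close> the only term not covered by earlier
  coefficients of \<open>f\<close> is \<open>g\<^sub>0 f\<^sub>i\<close>, and \<open>g\<^sub>0\<close> can be cancelled.
\<close>
lemma fps_cong_cancel_left:
  assumes unit: "coprime (fps_nth g 0) m" and gg: "fps_cong m n g g'"
    and prod: "fps_cong m n (g * f) (g' * f')"
  shows "fps_cong m n f f'"
proof -
  have "[fps_nth f i = fps_nth f' i] (mod m)" if "i < n" for i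
    using that
  proof (induction i rule: less_induct)
    case (less i)
    have "[fps_nth g j * fps_nth f (i - j) = fps_nth g' j * fps_nth f' (i - j)] (mod m)"
      if "j \<in> {1..i}" for j
      using that less gg by (intro cong_mult) (auto simp: fps_cong_def)
    then have tail: "[(\<Sum>j=1..i. fps_nth g j * fps_nth f (i - j)) =
        (\<Sum>j=1..i. fps_nth g' j * fps_nth f' (i - j))] (mod m)"
      by (rule cong_sum)
    have head: "fps_nth (a * b) i =
        fps_nth a 0 * fps_nth b i + (\<Sum>j=1..i. fps_nth a j * fps_nth b (i - j))"
      for a b :: "int fps"
      by (simp add: fps_mult_nth sum.atLeast_Suc_atMost)
    have "[fps_nth (g * f) i = fps_nth (g' * f') i] (mod m)"
      using prod less.prems by (simp add: fps_cong_def)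
    from cong_diff[OF this[unfolded head] tail]
    have "[fps_nth g 0 * fps_nth f i = fps_nth g' 0 * fps_nth f' i] (mod m)"
      by simp
    also have "[fps_nth g' 0 * fps_nth f' i = fps_nth g 0 * fps_nth f' i] (mod m)"
      using gg less.prems by (intro cong_mult) (auto simp: fps_cong_def cong_sym)
    finally show ?case
      using unit cong_mult_lcancel by blast
  qed
  then show ?thesis by (simp add: fps_cong_def)
qed

section \<open>Counting truncated Riordan arrays over a prime field\<close>

text \<open>
  The columns are left unbounded: those with \<open>j > i\<close> vanish when \<open>f\<close> has zero constant term, so
  only the rows need truncation. Rows \<open>i \<ge> n\<close> are set to \<open>0\<close>, which makes equality of functions
  the same as equality of the first \<open>n\<close> rows.
\<close>
definition truncated_array :: "int \<Rightarrow> nat \<Rightarrow> int fps \<Rightarrow> int fps \<Rightarrow> nat \<Rightarrow> nat \<Rightarrow> int" where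
  "truncated_array m n g f = (\<lambda>i j. if i < n then riordan_matrix g f i j mod m else 0)"

definition truncated_arrays :: "int \<Rightarrow> nat \<Rightarrow> (nat \<Rightarrow> nat \<Rightarrow> int) set" where
  "truncated_arrays m n = {truncated_array m n g f | g f. fps_nth f 0 = 0}"

definition shift_rows :: "(nat \<Rightarrow> nat \<Rightarrow> int) \<Rightarrow> nat \<Rightarrow> nat \<Rightarrow> int" where
  "shift_rows a = (\<lambda>i j. case i of 0 \<Rightarrow> 0 | Suc k \<Rightarrow> a k j)"

text \<open>
  Here \<open>c\<close> is the constant term of \<open>g\<close>, while \<open>u k\<close> and \<open>v k\<close> are the coefficients of \<open>t ^ (k + 1)\<close>
  in \<open>g\<close> and \<open>f\<close>.
\<close>
definition unit_array :: "int \<Rightarrow> nat \<Rightarrow> int \<times> (nat \<Rightarrow> int) \<times> (nat \<Rightarrow> int) \<Rightarrow> nat \<Rightarrow> nat \<Rightarrow> int" where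
  "unit_array m n = (\<lambda>(c, u, v).
     truncated_array m (Suc n) (fps_const c + fps_X * Abs_fps u) (fps_X * Abs_fps v))"

text \<open>The series \<open>g f\<^sup>j\<close> is divisible by \<open>t\<^sup>j\<close>.\<close>
lemma riordan_matrix_above_diagonal:
  assumes "fps_nth f 0 = 0" and "i < j"
  shows "riordan_matrix g f i j = 0"
proof -
  have "f = fps_X * fps_shift 1 f"
    using assms(1) by (intro fps_ext) auto
  then have "f ^ j = fps_X ^ j * fps_shift 1 f ^ j"
    by (metis power_mult_distrib)
  then have "g * f ^ j = fps_X ^ j * (g * fps_shift 1 f ^ j)"
    by (simp only: mult.left_commute)
  then show ?thesis
    using assms(2) unfolding riordan_matrix_def by (simp only: fps_X_power_mult_nth if_True)
qed

lemma riordan_matrix_X_mult: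
  "riordan_matrix (fps_X * g) f i j = (case i of 0 \<Rightarrow> 0 | Suc k \<Rightarrow> riordan_matrix g f k j)"
  by (simp add: riordan_matrix_def mult.assoc split: nat.split)

lemma truncated_array_cong:
  assumes "fps_cong m n g g'" and "fps_cong m n f f'"
  shows "truncated_array m n g f = truncated_array m n g' f'"
proof (intro ext)
  fix i j
  have "fps_cong m n (g * f ^ j) (g' * f' ^ j)"
    using assms by (intro fps_cong_mult fps_cong_power)
  then show "truncated_array m n g f i j = truncated_array m n g' f' i j"
    by (auto simp: truncated_array_def riordan_matrix_def fps_cong_def cong_def)
qed

lemma truncated_arrays_0: "truncated_arrays m 0 = {\<lambda>i j. 0}"
proof -
  have "\<exists>f :: int fps. fps_nth f 0 = 0"
    by (rule exI[of _ 0]) simp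
  then show ?thesis
    by (auto simp: truncated_arrays_def truncated_array_def)
qed

lemma shift_rows_truncated_array:
  "shift_rows (truncated_array m n g f) = truncated_array m (Suc n) (fps_X * g) f"
  by (intro ext) (auto simp: shift_rows_def truncated_array_def riordan_matrix_X_mult split: nat.split)

lemma inj_shift_rows: "inj shift_rows"
proof (rule injI, intro ext)
  fix a b :: "nat \<Rightarrow> nat \<Rightarrow> int" and i j
  assume "shift_rows a = shift_rows b"
  then have "shift_rows a (Suc i) j = shift_rows b (Suc i) j" by simp
  then show "a i j = b i j" by (simp add: shift_rows_def)
qed

abbreviation unit_data :: "nat \<Rightarrow> nat \<Rightarrow> (int \<times> (nat \<Rightarrow> int) \<times> (nat \<Rightarrow> int)) set" where
  "unit_data p n \<equiv> {1..<int p} \<times> ({..<n} \<rightarrow>\<^sub>E {0..<int p}) \<times> ({..<n} \<rightarrow>\<^sub>E {0..<int p})"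

lemma fps_nth_const_add_X_mult:
  "fps_nth (fps_const c + fps_X * Abs_fps u) i = (case i of 0 \<Rightarrow> c | Suc k \<Rightarrow> u k)"
  for c :: int
  by (simp split: nat.split)

text \<open>
  The two parts correspond to \<open>g\<^sub>0\<close> being zero or nonzero modulo \<open>p\<close>. In each case the series may
  be replaced by congruent ones: by \<open>t g'\<close> in the first case, and by the polynomials with
  reduced coefficients in the second.
\<close>
lemma truncated_arrays_Suc:
  assumes "p > 0"
  shows "truncated_arrays (int p) (Suc n) =
    shift_rows ` truncated_arrays (int p) n \<union> unit_array (int p) n ` unit_data p n"
    (is "_ = ?S \<union> ?U")
proof (intro subset_antisym subsetI)
  fix a assume "a \<in> truncated_arrays (int p) (Suc n)"
  then obtain g f where a: "a = truncated_array (int p) (Suc n) g f" and f: "fps_nth f 0 = 0"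
    by (auto simp: truncated_arrays_def)
  show "a \<in> ?S \<union> ?U"
  proof (cases "int p dvd fps_nth g 0")
    case True
    then have "fps_cong (int p) (Suc n) g (fps_X * fps_shift 1 g)"
      by (auto simp: fps_cong_def cong_0_iff)
    then have "a = truncated_array (int p) (Suc n) (fps_X * fps_shift 1 g) f"
      unfolding a by (intro truncated_array_cong fps_cong_refl)
    also have "\<dots> = shift_rows (truncated_array (int p) n (fps_shift 1 g) f)"
      by (simp add: shift_rows_truncated_array)
    finally show ?thesis
      using f by (auto simp: truncated_arrays_def)
  next
    case False
    let ?c = "fps_nth g 0 mod int p"
    let ?u = "\<lambda>k\<in>{..<n}. fps_nth g (Suc k) mod int p"
    let ?v = "\<lambda>k\<in>{..<n}. fps_nth f (Suc k) mod int p"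
    have "?c \<noteq> 0" "?c \<ge> 0" "?c < int p"
      using False assms by (auto simp: dvd_eq_mod_eq_0)
    then have "?c \<in> {1..<int p}" by simp
    then have "(?c, ?u, ?v) \<in> unit_data p n"
      using assms by auto
    moreover have "fps_cong (int p) (Suc n) g (fps_const ?c + fps_X * Abs_fps ?u)"
      unfolding fps_cong_def fps_nth_const_add_X_mult
      by (auto simp: cong_def split: nat.split)
    moreover have "fps_cong (int p) (Suc n) f (fps_X * Abs_fps ?v)"
      using f by (auto simp: fps_cong_def cong_def)
    ultimately have "a = unit_array (int p) n (?c, ?u, ?v)"
      unfolding a unit_array_def by (auto intro: truncated_array_cong)
    with \<open>(?c, ?u, ?v) \<in> unit_data p n\<close> show ?thesis by blast
  qed
next
  fix a assume "a \<in> ?S \<union> ?U"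
  then show "a \<in> truncated_arrays (int p) (Suc n)"
  proof
    assume "a \<in> ?S"
    then obtain g f where "a = truncated_array (int p) (Suc n) (fps_X * g) f" "fps_nth f 0 = 0"
      by (auto simp: truncated_arrays_def shift_rows_truncated_array)
    then show ?thesis
      unfolding truncated_arrays_def by blast
  next
    assume "a \<in> ?U"
    then obtain c u v where "a = unit_array (int p) n (c, u, v)"
      by auto
    moreover have "fps_nth (fps_X * Abs_fps v) 0 = 0" by simp
    ultimately show ?thesis
      unfolding truncated_arrays_def unit_array_def prod.case by blast
  qed
qed

text \<open>
  Column \<open>0\<close> of the array is \<open>g\<close> itself and column \<open>1\<close> is \<open>g f\<close>, from which \<open>f\<close> is recovered since
  the constant term of \<open>g\<close> is invertible modulo \<open>p\<close>. Coefficients in the range of reduced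
  residues are determined by their classes.
\<close>
lemma inj_on_unit_array:
  assumes "prime p"
  shows "inj_on (unit_array (int p) n) (unit_data p n)"
proof (rule inj_onI)
  fix x y assume x: "x \<in> unit_data p n" and y: "y \<in> unit_data p n"
    and eq: "unit_array (int p) n x = unit_array (int p) n y"
  obtain c u v c' u' v' where xy: "x = (c, u, v)" "y = (c', u', v')"
    by (metis surj_pair)
  define g g' where "g = fps_const c + fps_X * Abs_fps u"
    and "g' = fps_const c' + fps_X * Abs_fps u'"
  define f f' where "f = fps_X * Abs_fps v" and "f' = fps_X * Abs_fps v'"
  have eq: "truncated_array (int p) (Suc n) g f = truncated_array (int p) (Suc n) g' f'"
    using eq by (simp add: xy unit_array_def g_def g'_def f_def f'_def)
  have col: "fps_cong (int p) (Suc n) (g * f ^ j) (g' * f' ^ j)" for j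
    unfolding fps_cong_def
  proof (intro allI impI)
    fix i assume "i < Suc n"
    then show "[fps_nth (g * f ^ j) i = fps_nth (g' * f' ^ j) i] (mod int p)"
      using fun_cong[OF fun_cong[OF eq, of i], of j]
      by (simp add: truncated_array_def riordan_matrix_def cong_def)
  qed
  have gg: "fps_cong (int p) (Suc n) g g'"
    using col[of 0] by simp
  have "coprime (fps_nth g 0) (int p)"
  proof -
    have "\<not> int p dvd c"
      using x zdvd_imp_le[of "int p" c] by (auto simp: xy)
    moreover have "prime (int p)" using assms by simp
    ultimately have "coprime (int p) c" by (intro prime_imp_coprime)
    then show ?thesis by (simp add: g_def ac_simps)
  qed
  from fps_cong_cancel_left[OF this gg] have ff: "fps_cong (int p) (Suc n) f f'"
    using col[of 1] by simp
  have residue_eq: "a = b" if "[a = b] (mod int p)" "a \<in> {0..<int p}" "b \<in> {0..<int p}" for a b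
    using that by (simp add: cong_def)
  have "[c = c'] (mod int p)"
    using gg[unfolded fps_cong_def, rule_format, of 0] by (simp add: g_def g'_def)
  then have "c = c'"
    using x y by (intro residue_eq) (auto simp: xy)
  moreover have "u = u'"
  proof (rule PiE_ext)
    show "u \<in> {..<n} \<rightarrow>\<^sub>E {0..<int p}" "u' \<in> {..<n} \<rightarrow>\<^sub>E {0..<int p}"
      using x y by (auto simp only: xy mem_Sigma_iff)
    fix k assume k: "k \<in> {..<n}"
    have "[u k = u' k] (mod int p)"
      using gg[unfolded fps_cong_def, rule_format, of "Suc k"] k by (simp add: g_def g'_def)
    then show "u k = u' k"
      using x y k by (intro residue_eq) (auto simp only: xy mem_Sigma_iff PiE_iff)
  qed
  moreover have "v = v'"
  proof (rule PiE_ext)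
    show "v \<in> {..<n} \<rightarrow>\<^sub>E {0..<int p}" "v' \<in> {..<n} \<rightarrow>\<^sub>E {0..<int p}"
      using x y by (auto simp only: xy mem_Sigma_iff)
    fix k assume k: "k \<in> {..<n}"
    have "[v k = v' k] (mod int p)"
      using ff[unfolded fps_cong_def, rule_format, of "Suc k"] k by (simp add: f_def f'_def)
    then show "v k = v' k"
      using x y k by (intro residue_eq) (auto simp only: xy mem_Sigma_iff PiE_iff)
  qed
  ultimately show "x = y" by (simp add: xy)
qed

lemma finite_unit_data: "finite (unit_data p n)"
  by (intro finite_cartesian_product finite_PiE) auto

lemma card_unit_data: "card (unit_data p n) = (p - 1) * p ^ (2 * n)"
  by (simp add: card_cartesian_product card_PiE mult_2 power_add nat_diff_distrib')

text \<open>The entry in the top left corner, which is \<open>g\<^sub>0\<close> modulo \<open>p\<close>, separates the two kinds.\<close>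
lemma shift_rows_unit_array_disjoint:
  "shift_rows ` A \<inter> unit_array (int p) n ` unit_data p n = {}"
proof -
  have "shift_rows a \<noteq> unit_array (int p) n x" if "x \<in> unit_data p n" for a x
  proof
    obtain c u v where x: "x = (c, u, v)" by (metis surj_pair)
    assume "shift_rows a = unit_array (int p) n x"
    then have "shift_rows a 0 0 = unit_array (int p) n x 0 0" by simp
    then have "c mod int p = 0"
      by (simp add: x shift_rows_def unit_array_def truncated_array_def riordan_matrix_def)
    then show False
      using that by (auto simp: x)
  qed
  then show ?thesis by blast
qed

lemma finite_truncated_arrays: "p > 0 \<Longrightarrow> finite (truncated_arrays (int p) n)"
  by (induction n) (simp_all only: truncated_arrays_0 truncated_arrays_Suc finite_Un
      finite_imageI finite_unit_data finite.intros simp_thms)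

lemma card_truncated_arrays_Suc:
  assumes "prime p"
  shows "card (truncated_arrays (int p) (Suc n)) =
    card (truncated_arrays (int p) n) + (p - 1) * p ^ (2 * n)"
proof -
  have p: "p > 0" using assms by (rule prime_gt_0_nat)
  show ?thesis
    unfolding truncated_arrays_Suc[OF p]
    by (subst card_Un_disjoint)
      (simp_all only: finite_imageI finite_truncated_arrays[OF p] finite_unit_data
        shift_rows_unit_array_disjoint card_image inj_on_unit_array[OF assms]
        card_unit_data inj_on_subset[OF inj_shift_rows] subset_UNIV)
qed

section \<open>Graphs and truncated arrays\<close>

text \<open>
  The row index drops by one below the diagonal because the adjacency matrix is built from
  \<open>(t g, f)\<close> rather than from \<open>(g, f)\<close>.
\<close>
definition array_graph :: "nat \<Rightarrow> (nat \<Rightarrow> nat \<Rightarrow> int) \<Rightarrow> int mat" where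
  "array_graph n a = mat (n + 1) (n + 1)
     (\<lambda>(i, j). if j < i then a (i - 1) j else if i < j then a (j - 1) i else 0)"

text \<open>
  The matrix \<open>(t g, f)\<close> is strictly lower triangular, so its sum with the transpose never adds
  two nonzero entries, and reduction modulo \<open>m\<close> acts on the two halves separately.
\<close>
lemma riordan_submatrix_add_transpose_mod:
  assumes "fps_nth f 0 = 0" and "i < n + 1" and "j < n + 1"
  shows "(riordan_submatrix (n + 1) (fps_X * g) f +
      transpose_mat (riordan_submatrix (n + 1) (fps_X * g) f)) $$ (i, j) mod m =
    array_graph n (truncated_array m n g f) $$ (i, j)"
proof -
  have above: "riordan_matrix (fps_X * g) f i j = 0" if "i \<le> j" for i j
    using that riordan_matrix_above_diagonal[OF assms(1)]
    by (auto simp: riordan_matrix_X_mult split: nat.split)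
  have below: "riordan_matrix (fps_X * g) f i j = riordan_matrix g f (i - 1) j" if "j < i" for i j
    using that by (auto simp: riordan_matrix_X_mult split: nat.split)
  show ?thesis
    using assms(2,3) by (cases i j rule: linorder_cases)
      (auto simp: riordan_submatrix_def array_graph_def truncated_array_def above below)
qed

lemma oriented_riordan_graphs_eq_image:
  "oriented_riordan_graphs (n + 1) = array_graph n ` truncated_arrays 3 n"
proof (intro subset_antisym subsetI)
  fix A assume "A \<in> oriented_riordan_graphs (n + 1)"
  then obtain g f where A: "A \<in> carrier_mat (n + 1) (n + 1)" "elements_mat A \<subseteq> {0, 1, 2}"
    and f: "fps_nth f 0 = 0"
    and cong: "cong_mat A (riordan_submatrix (n + 1) (fps_X * g) f +
             transpose_mat (riordan_submatrix (n + 1) (fps_X * g) f)) 3"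
    by (auto simp: oriented_riordan_graphs_def)
  have "A = array_graph n (truncated_array 3 n g f)"
  proof (rule eq_matI)
    fix i j assume "i < dim_row (array_graph n (truncated_array 3 n g f))"
      "j < dim_col (array_graph n (truncated_array 3 n g f))"
    then have ij: "i < n + 1" "j < n + 1" by (auto simp: array_graph_def)
    have "A $$ (i, j) \<in> elements_mat A"
      using A(1) ij by (intro elements_matI) auto
    then have "A $$ (i, j) = A $$ (i, j) mod 3"
      using A(2) by auto
    also have "\<dots> = array_graph n (truncated_array 3 n g f) $$ (i, j)"
      using cong A(1) ij riordan_submatrix_add_transpose_mod[OF f ij, of g 3]
      by (auto simp: cong_mat_def cong_def)
    finally show "A $$ (i, j) = array_graph n (truncated_array 3 n g f) $$ (i, j)" .
  qed (use A(1) in \<open>auto simp: array_graph_def\<close>)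
  then show "A \<in> array_graph n ` truncated_arrays 3 n"
    using f by (auto simp: truncated_arrays_def)
next
  fix A assume "A \<in> array_graph n ` truncated_arrays 3 n"
  then obtain g f where A: "A = array_graph n (truncated_array 3 n g f)" and f: "fps_nth f 0 = 0"
    by (auto simp: truncated_arrays_def)
  have dim: "A \<in> carrier_mat (n + 1) (n + 1)"
    by (simp add: A array_graph_def)
  have entry: "A $$ (i, j) = (riordan_submatrix (n + 1) (fps_X * g) f +
      transpose_mat (riordan_submatrix (n + 1) (fps_X * g) f)) $$ (i, j) mod 3"
    if "i < n + 1" "j < n + 1" for i j
    using riordan_submatrix_add_transpose_mod[OF f that] by (simp add: A)
  have "elements_mat A \<subseteq> {0, 1, 2}"
  proof
    fix x assume "x \<in> elements_mat A"
    then obtain i j where "i < n + 1" "j < n + 1" "x = A $$ (i, j)"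
      using dim elements_matD by (metis carrier_matD)
    with entry obtain y where "x = y mod (3 :: int)" by blast
    moreover have "y mod 3 \<ge> 0" "y mod 3 < 3" by simp_all
    ultimately show "x \<in> {0, 1, 2}" by auto
  qed
  moreover have "cong_mat A (riordan_submatrix (n + 1) (fps_X * g) f +
      transpose_mat (riordan_submatrix (n + 1) (fps_X * g) f)) 3"
    using dim entry by (auto simp: cong_mat_def cong_def riordan_submatrix_def)
  ultimately show "A \<in> oriented_riordan_graphs (n + 1)"
    using dim f by (auto simp: oriented_riordan_graphs_def)
qed

text \<open>
  The graph retains all entries with \<open>j \<le> i < n\<close>; outside this range every truncated Riordan array is
  zero, so nothing is lost.
\<close>
lemma inj_on_array_graph: "inj_on (array_graph n) (truncated_arrays m n)"
proof (rule inj_onI)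
  fix a b assume a: "a \<in> truncated_arrays m n" and b: "b \<in> truncated_arrays m n"
    and eq: "array_graph n a = array_graph n b"
  have zero: "c i j = 0" if "c \<in> truncated_arrays m n" "\<not> (j \<le> i \<and> i < n)" for c i j
    using that riordan_matrix_above_diagonal
    by (force simp: truncated_arrays_def truncated_array_def)
  show "a = b"
  proof (intro ext)
    fix i j
    show "a i j = b i j"
    proof (cases "j \<le> i \<and> i < n")
      case True
      have "array_graph n a $$ (Suc i, j) = array_graph n b $$ (Suc i, j)"
        using eq by simp
      with True show ?thesis by (simp add: array_graph_def)
    next
      case False
      with a b show ?thesis by (simp add: zero)
    qed
  qed
qed

section \<open>Counting balanced words\<close>

abbreviation ternary_words :: "nat \<Rightarrow> nat list set" where
  "ternary_words k \<equiv> {w. set w \<subseteq> {0, 1, 2} \<and> length w = k}"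

abbreviation balancing_pairs :: "nat list \<Rightarrow> (nat \<times> nat) set" where
  "balancing_pairs w \<equiv> {(x, y). x \<in> {0, 1, 2} \<and> y \<in> {0, 1, 2} \<and>
     (\<forall>a \<in> {0, 1, 2}. even (count_list (x # y # w) a))}"

text \<open>
  The numbers of occurrences add up to an even length, which leaves four possible parity patterns:
  all even, or exactly two odd.
\<close>
lemma card_balancing_pairs:
  assumes "w \<in> ternary_words (2 * n)"
  shows "card (balancing_pairs w) = (if w \<in> balanced_words n then 3 else 2)"
proof -
  let ?c = "count_list w"
  have "?c 0 + ?c 1 + ?c 2 = 2 * n"
  proof -
    have "sum ?c {0, 1, 2} = length w"
      using assms by (metis (no_types, lifting) mem_Collect_eq finite.intros
          sum_count_set)
    then show ?thesis using assms by simp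
  qed
  then have "even (?c 0 + ?c 1 + ?c 2)" by simp
  then consider "even (?c 0)" "even (?c 1)" "even (?c 2)"
    | "even (?c 0)" "odd (?c 1)" "odd (?c 2)"
    | "odd (?c 0)" "even (?c 1)" "odd (?c 2)"
    | "odd (?c 0)" "odd (?c 1)" "even (?c 2)"
    by auto
  then show ?thesis
  proof cases
    case 1
    then have "balancing_pairs w = {(0, 0), (1, 1), (2, 2)}" by auto
    then show ?thesis using 1 assms by (simp add: balanced_words_def)
  next
    case 2
    then have "balancing_pairs w = {(1, 2), (2, 1)}" by auto
    then show ?thesis using 2 by (simp add: balanced_words_def)
  next
    case 3
    then have "balancing_pairs w = {(0, 2), (2, 0)}" by auto
    then show ?thesis using 3 by (simp add: balanced_words_def)
  next
    case 4
    then have "balancing_pairs w = {(0, 1), (1, 0)}" by auto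
    then show ?thesis using 4 by (simp add: balanced_words_def)
  qed
qed

lemma balanced_words_subset: "balanced_words n \<subseteq> ternary_words (2 * n)"
  by (auto simp: balanced_words_def)

lemma finite_ternary_words: "finite (ternary_words k)"
  by (rule finite_lists_length_eq) simp

text \<open>Classify the balanced words of length \<open>2 n + 2\<close> by what remains after their first two letters.\<close>
lemma card_balanced_words_Suc:
  "card (balanced_words (Suc n)) = card (balanced_words n) + 2 * 9 ^ n"
proof -
  let ?W = "ternary_words (2 * n)"
  let ?P = "SIGMA w:?W. balancing_pairs w"
  have mem_P: "(w, x, y) \<in> ?P \<longleftrightarrow> x # y # w \<in> balanced_words (Suc n)" for w x y
  proof -
    have "length (x # y # w) = 2 * Suc n \<longleftrightarrow> length w = 2 * n" by simp
    then show ?thesis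
      by (simp only: balanced_words_def mem_Sigma_iff mem_Collect_eq case_prod_conv
          list.set insert_subset conj_ac)
  qed
  have "balanced_words (Suc n) = (\<lambda>(w, x, y). x # y # w) ` ?P"
  proof (intro subset_antisym subsetI)
    fix w assume w: "w \<in> balanced_words (Suc n)"
    then have "length w = Suc (Suc (2 * n))"
      by (simp add: balanced_words_def)
    then obtain x y v where xyv: "w = x # y # v"
      by (metis length_Suc_conv)
    with w have "(v, x, y) \<in> ?P" by (simp only: mem_P)
    then show "w \<in> (\<lambda>(w, x, y). x # y # w) ` ?P"
      by (rule rev_image_eqI) (simp add: xyv)
  next
    fix w assume "w \<in> (\<lambda>(w, x, y). x # y # w) ` ?P"
    then obtain q where q: "q \<in> ?P" "w = (\<lambda>(w, x, y). x # y # w) q"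
      by (rule imageE)
    obtain v x y where "q = (v, x, y)" by (metis surj_pair)
    with q show "w \<in> balanced_words (Suc n)"
      by (simp only: mem_P case_prod_conv)
  qed
  moreover have "inj (\<lambda>(w, x, y). x # y # w :: nat list)"
    by (auto intro: injI)
  then have "inj_on (\<lambda>(w, x, y). x # y # w) ?P"
    by (rule inj_on_subset) (rule subset_UNIV)
  ultimately have "card (balanced_words (Suc n)) = card ?P"
    by (simp only: card_image)
  also have "\<dots> = (\<Sum>w\<in>?W. card (balancing_pairs w))"
  proof (rule card_SigmaI)
    have "balancing_pairs w \<subseteq> {0, 1, 2} \<times> {0, 1, 2}" for w
      by (rule subsetI) (simp only: split_paired_all mem_Collect_eq case_prod_conv mem_Sigma_iff)
    moreover have "finite ({0, 1, 2} \<times> {0, 1, 2 :: nat} :: (nat \<times> nat) set)" by simp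
    ultimately show "\<forall>w\<in>?W. finite (balancing_pairs w)"
      by (intro ballI) (rule finite_subset)
  qed (rule finite_ternary_words)
  also have "\<dots> = (\<Sum>w\<in>?W. (if w \<in> balanced_words n then 1 else 0) + 2)"
    by (intro sum.cong refl) (simp only: card_balancing_pairs, simp)
  also have "\<dots> = card (?W \<inter> balanced_words n) + 2 * card ?W"
    by (simp only: sum.distrib sum.If_cases[OF finite_ternary_words] Collect_mem_eq
        sum_constant sum.neutral_const) simp
  also have "?W \<inter> balanced_words n = balanced_words n"
    using balanced_words_subset by blast
  also have "card ?W = 9 ^ n"
  proof -
    have "card ?W = 3 ^ (2 * n)" by (subst card_lists_length_eq) (simp_all add: numeral_eq_Suc)
    then show ?thesis by (simp add: power_mult)
  qed
  finally show ?thesis .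
qed

lemma card_truncated_arrays_eq_card_balanced_words:
  "card (truncated_arrays 3 n) = card (balanced_words n)"
proof (induction n)
  case 0
  have "balanced_words 0 = {[]}" by (auto simp: balanced_words_def)
  then show ?case by (simp add: truncated_arrays_0)
next
  case (Suc n)
  have "prime (3 :: nat)" by simp
  from card_truncated_arrays_Suc[OF this, of n] Suc show ?case
    by (simp add: card_balanced_words_Suc power_mult)
qed

theorem theorem4p1:
  fixes n :: nat
  assumes "n \<ge> 1"
  shows "\<exists>\<phi>. bij_betw \<phi> (oriented_riordan_graphs (n + 1)) (balanced_words n)"
proof (rule finite_same_card_bij)
  show "finite (oriented_riordan_graphs (n + 1))"
    unfolding oriented_riordan_graphs_eq_image
    using finite_truncated_arrays[of 3 n] by simp
  show "finite (balanced_words n)"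
    using balanced_words_subset finite_ternary_words by (rule finite_subset)
  show "card (oriented_riordan_graphs (n + 1)) = card (balanced_words n)"
    unfolding oriented_riordan_graphs_eq_image card_image[OF inj_on_array_graph]
    by (rule card_truncated_arrays_eq_card_balanced_words)
qed

end
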